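(* Let $n\ge 0$ be an integer. Then $D_n(1,x)$ is a permutation polynomial over $\mathbb{Z}_5$ if and only if $n$ is congruent to one of $2,3,6,10,15$ modulo $24$.
   Context: The $n$th reversed Dickson polynomial of the first kind (with parameter $1$) is the integer-coefficient polynomial $D_n(1,x)$ defined by $D_0(1,x)=2$, $D_1(1,x)=1$, $D_n(1,x)=D_{n-1}(1,x)-x\,D_{n-2}(1,x)$ for $n\ge 2$. A polynomial is a permutation polynomial over $\mathbb{Z}_5$ (the integers modulo $5$) if the map it induces $\mathbb{Z}_5\to\mathbb{Z}_5$ is a bijection. *)

theory Defs
  imports "HOL-Library.Numeral_Type" "HOL-Computational_Algebra.Polynomial"
begin

text \<open>Reversed Dickson polynomials of the first kind with parameter \<open>1\<close>, that is
  \<open>D\<^sub>n(1,x)\<close>.\<close>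

fun reversed_dickson :: "nat \<Rightarrow> int poly" where
  "reversed_dickson 0 = 2"
| "reversed_dickson (Suc 0) = 1"
| "reversed_dickson (Suc (Suc n)) =
     reversed_dickson (Suc n) - [:0, 1:] * reversed_dickson n"

text \<open>An integer polynomial is read over a ring \<open>'a\<close> by reducing its coefficients along the
  canonical map from the integers.  For \<open>\<int>/5\<close> the ring is the numeral type \<open>5\<close>, whose
  arithmetic is arithmetic modulo \<open>5\<close>.\<close>

definition permutation_polynomial_over :: "'a::comm_ring_1 itself \<Rightarrow> int poly \<Rightarrow> bool" where
  "permutation_polynomial_over _ p \<longleftrightarrow> bij (poly (map_poly of_int p :: 'a poly))"

end

theory Submission
  imports Defs
begin

text \<open>
  If \<open>x = y (1 - y)\<close> then \<open>D\<^sub>n(1,x) = y\<^sup>n + (1 - y)\<^sup>n\<close>, since \<open>y\<close> and \<open>1 - y\<close> are the two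
  roots of \<open>T\<^sup>2 - T + x\<close>.  For \<open>x \<in> \<int>/5\<close> both roots lie in the field with \<open>25\<close> elements, whose
  nonzero elements satisfy \<open>z\<^sup>2\<^sup>4 = 1\<close>.  So for \<open>x \<noteq> 0\<close> the value depends only on \<open>n\<close> modulo
  \<open>24\<close>; for \<open>x = 0\<close>, where one root vanishes, this holds once \<open>n \<ge> 1\<close>, since \<open>0\<^sup>n = 0\<close> only then.
  This reduces the question to the indices \<open>1, \<dots>, 24\<close> and to \<open>n = 0\<close>, where the polynomial is
  constant.

  The five residues can be understood as follows.  \<open>D\<^sub>2 = 1 - 2 x\<close> and \<open>D\<^sub>3 = 1 - 3 x\<close> are linear, and
  modulo \<open>5\<close> one has \<open>D\<^sub>6 = -2 ((x + 1)\<^sup>3 + 1)\<close>, where cubing is a bijection because \<open>3\<close> is prime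
  to \<open>5 - 1\<close>.  Raising to the fifth power shows that \<open>D\<^sub>5\<^sub>n\<close> and \<open>D\<^sub>n\<close> induce the same map, which turns
  \<open>2\<close> and \<open>3\<close> into \<open>10\<close> and \<open>15\<close>.  That no other index works is a finite computation, and the
  proof below lets this computation decide all \<open>24\<close> indices at once
  (\<open>inj_dickson_state_table\<close>).

  The extension field does not appear in the formal proof: the recurrence is iteration of the linear
  map \<open>(a, b) \<mapsto> (b, b - x a)\<close>, and the period is read off from a return of this iteration to an
  earlier state (\<open>dickson_state_return\<close>, \<open>dickson_state_period\<close>).
\<close>

text \<open>
  Two consecutive values of the sequence are carried together.  This makes the sequence an orbit, so
  that one coincidence of states already forces periodicity, and a value is computed in linearly many
  steps, whereas unfolding the two-term recurrence branches exponentially.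
\<close>

definition dickson_step :: "'a::comm_ring_1 \<Rightarrow> 'a \<times> 'a \<Rightarrow> 'a \<times> 'a" where
  "dickson_step x = (\<lambda>(a, b). (b, b - x * a))"

lemma dickson_step_pair [simp]: "dickson_step x (a, b) = (b, b - x * a)"
  by (simp add: dickson_step_def)

definition dickson_state :: "nat \<Rightarrow> 'a::comm_ring_1 \<Rightarrow> 'a \<times> 'a" where
  "dickson_state n x = (dickson_step x ^^ n) (2, 1)"

lemma dickson_state_simps:
  "dickson_state 0 x = (2, 1)"
  "dickson_state (Suc n) x = dickson_step x (dickson_state n x)"
  "dickson_state (numeral k) x = dickson_step x (dickson_state (pred_numeral k) x)"
  by (simp_all add: dickson_state_def numeral_eq_Suc)

lemma poly_reversed_dickson_rec:
  fixes x :: "'a::comm_ring_1"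
  shows "poly (map_poly of_int (reversed_dickson (Suc (Suc n)))) x =
    poly (map_poly of_int (reversed_dickson (Suc n))) x -
    x * poly (map_poly of_int (reversed_dickson n)) x"
proof -
  have "map_poly of_int (reversed_dickson (Suc (Suc n))) =
      map_poly of_int (reversed_dickson (Suc n)) -
      pCons (0::'a) (map_poly of_int (reversed_dickson n))"
    by (rule poly_eqI) (simp add: coeff_map_poly coeff_pCons split: nat.split)
  then show ?thesis by simp
qed

lemma dickson_state_eq:
  "dickson_state n (x::'a::comm_ring_1) =
    (poly (map_poly of_int (reversed_dickson n)) x,
     poly (map_poly of_int (reversed_dickson (Suc n))) x)"
proof (induction n)
  case 0
  have "map_poly of_int (2 :: int poly) = [:2 :: 'a:]"
    by (rule poly_eqI) (simp add: coeff_map_poly numeral_poly coeff_pCons split: nat.split)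
  then show ?case by (simp add: dickson_state_simps)
next
  case (Suc n)
  show ?case
    unfolding dickson_state_simps(2) Suc.IH poly_reversed_dickson_rec by simp
qed

lemma UNIV_mod_5: "(UNIV :: 5 set) = set [0, 1, 2, 3, 4]"
proof (rule card_subset_eq[symmetric])
  show "card (set [0, 1, 2, 3, 4 :: 5]) = card (UNIV :: 5 set)" by simp
qed auto

lemma inj_mod_5_iff_distinct: "inj (f :: 5 \<Rightarrow> 'a) \<longleftrightarrow> distinct [f 0, f 1, f 2, f 3, f 4]"
  using distinct_map[of f "[0, 1, 2, 3, 4]"] unfolding UNIV_mod_5 by simp

text \<open>
  The return is to index \<open>1\<close>, not to index \<open>0\<close>: at \<open>x = 0\<close> the orbit is \<open>(2, 1), (1, 1), (1, 1), \<dots>\<close>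
  and never revisits its initial state.
\<close>

lemma dickson_state_return: "dickson_state 25 (x::5) = dickson_state 1 x"
proof -
  have "x \<in> set [0, 1, 2, 3, 4]" using UNIV_mod_5 by blast
  then have "x = 0 \<or> x = 1 \<or> x = 2 \<or> x = 3 \<or> x = 4" by simp
  then show ?thesis by (elim disjE) (simp_all add: dickson_state_simps)
qed

lemma dickson_state_period:
  assumes "n \<ge> 1"
  shows "dickson_state (n + 24) (x::5) = dickson_state n x"
proof -
  obtain m where n: "n = m + 1" using assms by (metis le_add_diff_inverse2)
  have split: "dickson_state (m + k) x = (dickson_step x ^^ m) (dickson_state k x)" for k
    by (simp add: dickson_state_def funpow_add)
  show ?thesis
    using split[of 25] split[of 1] by (simp add: n dickson_state_return add.commute)
qed

lemma dickson_state_reduce: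
  "dickson_state (Suc m) (x::5) = dickson_state (Suc (m mod 24)) x"
proof (induction m rule: less_induct)
  case (less m)
  show ?case
  proof (cases "m < 24")
    case False
    have "dickson_state (Suc m) x = dickson_state (Suc (m - 24)) x"
      using dickson_state_period[of "Suc (m - 24)" x] False by simp
    also have "\<dots> = dickson_state (Suc (m mod 24)) x"
      using less[of "m - 24"] False by (simp add: le_mod_geq)
    finally show ?thesis .
  qed simp
qed

text \<open>
  The index is shifted to \<open>Suc m\<close> so that the \<open>24\<close> cases run over \<open>1, \<dots>, 24\<close>.  The residue \<open>0\<close> is
  thus tested at index \<open>24\<close>, inside the periodic part of the orbit.
\<close>

lemma inj_dickson_state_table:
  assumes "m < 24"
  shows "inj (\<lambda>x::5. fst (dickson_state (Suc m) x)) \<longleftrightarrow> Suc m mod 24 \<in> {2, 3, 6, 10, 15}"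
proof -
  \<comment> \<open>With the index and the points of \<open>\<int>/5\<close> made explicit numerals, every state simplifies to a
    pair of numerals modulo \<open>5\<close>.\<close>
  have "[0..<24] = [0, 1, 2, 3, 4, 5, 6, 7, 8, 9, 10, 11,
      12, 13, 14, 15, 16, 17, 18, 19, 20, 21, 22, 23]"
    by code_simp
  moreover have "m \<in> set [0..<24]" using assms by simp
  ultimately have "m \<in> set [0, 1, 2, 3, 4, 5, 6, 7, 8, 9, 10, 11,
      12, 13, 14, 15, 16, 17, 18, 19, 20, 21, 22, 23]"
    by argo
  then show ?thesis
    unfolding inj_mod_5_iff_distinct list.set insert_iff empty_iff
    by (elim disjE FalseE) (simp_all add: dickson_state_simps)
qed

theorem theorem5p1:
  fixes n :: nat
  shows "permutation_polynomial_over TYPE(5) (reversed_dickson n)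
     \<longleftrightarrow> n mod 24 \<in> {2, 3, 6, 10, 15}"
proof -
  have eval: "poly (map_poly of_int (reversed_dickson n) :: 5 poly) =
      (\<lambda>x. fst (dickson_state n x))"
    by (simp add: dickson_state_eq)
  have perm: "permutation_polynomial_over TYPE(5) (reversed_dickson n) \<longleftrightarrow>
      inj (\<lambda>x::5. fst (dickson_state n x))"
    unfolding permutation_polynomial_over_def eval
    using finite_UNIV_inj_surj[of "\<lambda>x::5. fst (dickson_state n x)"] by (auto simp: bij_def)
  show ?thesis
  proof (cases n)
    case 0
    \<comment> \<open>Periodicity does not reach back to index \<open>0\<close>, so this case needs its own argument.\<close>
    have "\<not> inj (\<lambda>x::5. fst (dickson_state 0 x))"
    proof
      assume "inj (\<lambda>x::5. fst (dickson_state 0 x))"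
      then have "(0::5) = 1" by (rule injD) (simp add: dickson_state_simps)
      then show False by simp
    qed
    with 0 perm show ?thesis by simp
  next
    case (Suc m)
    have "inj (\<lambda>x::5. fst (dickson_state n x)) \<longleftrightarrow>
        inj (\<lambda>x::5. fst (dickson_state (Suc (m mod 24)) x))"
      unfolding Suc using dickson_state_reduce[of m] by simp
    also have "\<dots> \<longleftrightarrow> Suc (m mod 24) mod 24 \<in> {2, 3, 6, 10, 15}"
      by (rule inj_dickson_state_table) simp
    also have "Suc (m mod 24) mod 24 = n mod 24"
      unfolding Suc by (rule mod_Suc_eq)
    finally show ?thesis using perm by simp
  qed
qed

end
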